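(* Let $\mathcal X=\mathcal X_1\triangleleft^{h_1}\mathcal X_2\triangleleft^{h_2}\cdots\triangleleft^{h_{n-1}}\mathcal X_n$, where each $\mathcal X_k=\Delta^{s_k}$ ($s_k\in\mathbb N_{\ge1}$) is a probability simplex, and where, for each $k=1,\dots,n-1$, $h_k$ is a linear function on $\mathcal U_k=\mathcal X_1\triangleleft^{h_1}\cdots\triangleleft^{h_{k-1}}\mathcal X_k$ of the form $h_k(u_1,\dots,u_k)=a_{k,1}^\top u_1+\dots+a_{k,k}^\top u_k$ with $a_k=(a_{k,1},\dots,a_{k,k})\in[0,1]^{s_1}\times\dots\times[0,1]^{s_k}$, nonnegative on $\mathcal U_k$, strictly positive on $\operatorname{relint}\mathcal U_k$, and satisfying $h_k(u)\le1$ for all $u\in\mathcal U_k$. Define $\tilde\varphi:\mathcal X\to\mathbb R$ by \[ \begin{aligned} \tilde\varphi(x_1,\dots,x_n)=&\sum_{k=1}^n\alpha_k\sum_{i=1}^{s_k}x_k[i]\log x_k[i]-\sum_{k=2}^n\alpha_k h_{k-1}(x_1,\dots,x_{k-1})\log h_{k-1}(x_1,\dots,x_{k-1})\\ &+\alpha_1\log s_1+\sum_{k=2}^n\alpha_k h_{k-1}(x_1,\dots,x_{k-1})\log s_k, \end{aligned} \] where the coefficients $\alpha_k$ are defined recursively by \[ \alpha_n=1,\qquad \alpha_k=1+\Big\|\sum_{p=k}^{n-1}\alpha_{p+1}\|a_p\|_0\,a_{p,k}\Big\|_\infty\quad\forall k=n-1,\dots,1. \] Then $\tilde\varphi$ is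 $1$-strongly convex with respect to the Euclidean norm, and $(1/M_{\mathcal X})$-strongly convex with respect to the $\ell_1$ norm, where $M_{\mathcal X}=\max_{x\in\mathcal X}\|x\|_1$.
   Context: Scaled extension: for nonempty convex sets $\mathcal U,\mathcal V$ and a nonnegative affine real function $h$ on $\mathcal U$, $\mathcal U\triangleleft^h\mathcal V=\{(u,h(u)v):u\in\mathcal U,v\in\mathcal V\}$. The chain is read left to right: $\mathcal U_1=\mathcal X_1$ and $\mathcal U_{k+1}=\mathcal U_k\triangleleft^{h_k}\mathcal X_{k+1}$, $\mathcal X=\mathcal U_n$. $\Delta^s=\{y\in\mathbb R^s_{\ge0}:\sum_i y[i]=1\}$. $v[i]$ denotes the $i$-th coordinate of a vector $v$; $\|v\|_0$ is the number of nonzero coordinates of $v$. Convention: $0\log0=0$. A function $d$ on $\mathcal X$ is $\mu$-strongly convex with respect to $\|\cdot\|$ if $(\nabla d(x)-\nabla d(x'))^\top(x-x')\ge\mu\|x-x'\|^2$ for all $x,x'\in\operatorname{relint}\mathcal X$. The function $\tilde\varphi$ is called the dilatable global entropy for $\mathcal X$. *)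

theory Defs
  imports "HOL-Analysis.Analysis"
begin

text \<open>
  Encoding. The product of the spaces of dimensions \<open>s 1, \<dots>, s n\<close> is the single Euclidean
  space \<open>real ^ 'i\<close>, where a function \<open>blk :: 'i \<Rightarrow> nat\<close> tells to which factor a coordinate
  belongs; the \<open>k\<close>-th factor consists of the \<open>s k\<close> coordinates \<open>j\<close> with \<open>blk j = k\<close>.
  A vector of the product of the first \<open>k\<close> factors only is padded with zeros, so that
  the pair \<open>(u, w)\<close> of a vector \<open>u\<close> of the first \<open>k\<close> factors and a vector \<open>w\<close> of factor \<open>k + 1\<close>
  is \<open>u + w\<close>.
\<close>

definition block :: "('i::finite \<Rightarrow> nat) \<Rightarrow> nat \<Rightarrow> real ^ 'i \<Rightarrow> real ^ 'i" where
  "block blk k x = (\<chi> j. if blk j = k then x $ j else 0)"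

definition block_simplex :: "('i::finite \<Rightarrow> nat) \<Rightarrow> nat \<Rightarrow> (real ^ 'i) set" where
  "block_simplex blk k =
     {y. (\<forall>j. 0 \<le> y $ j) \<and> (\<forall>j. blk j \<noteq> k \<longrightarrow> y $ j = 0) \<and> (\<Sum>j | blk j = k. y $ j) = 1}"

text \<open>
  This is the set of all \<open>(u, h u v)\<close> with \<open>u \<in> U\<close>, \<open>v \<in> V\<close>, provided that \<open>U\<close> and \<open>V\<close> live on
  disjoint sets of coordinates.
\<close>

definition scaled_ext :: "(real ^ 'i::finite) set \<Rightarrow> (real ^ 'i \<Rightarrow> real) \<Rightarrow> (real ^ 'i) set
    \<Rightarrow> (real ^ 'i) set" where
  "scaled_ext U h V = {u + h u *\<^sub>R v | u v. u \<in> U \<and> v \<in> V}"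

text \<open>The sets are numbered from 1; the value at 0 is never used.\<close>

fun scaled_chain :: "(nat \<Rightarrow> (real ^ 'i::finite) set) \<Rightarrow> (nat \<Rightarrow> real ^ 'i \<Rightarrow> real) \<Rightarrow> nat
    \<Rightarrow> (real ^ 'i) set" where
  "scaled_chain Xs h 0 = {0}"
| "scaled_chain Xs h (Suc 0) = Xs 1"
| "scaled_chain Xs h (Suc (Suc k)) =
     scaled_ext (scaled_chain Xs h (Suc k)) (h (Suc k)) (Xs (Suc (Suc k)))"

text \<open>Only the first \<open>k\<close> factors of \<open>u\<close> contribute to \<open>scale_fun blk a k u\<close>.\<close>

definition scale_fun :: "('i::finite \<Rightarrow> nat) \<Rightarrow> (nat \<Rightarrow> real ^ 'i) \<Rightarrow> nat \<Rightarrow> real ^ 'i \<Rightarrow> real" where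
  "scale_fun blk a k u = (\<Sum>m=1..k. block blk m (a k) \<bullet> block blk m u)"

definition simplex_chain :: "('i::finite \<Rightarrow> nat) \<Rightarrow> (nat \<Rightarrow> real ^ 'i) \<Rightarrow> nat \<Rightarrow> (real ^ 'i) set" where
  "simplex_chain blk a = scaled_chain (block_simplex blk) (scale_fun blk a)"

definition l0_norm :: "real ^ 'i::finite \<Rightarrow> nat" where
  "l0_norm x = card {j. x $ j \<noteq> 0}"

definition l1_norm :: "real ^ 'i::finite \<Rightarrow> real" where
  "l1_norm x = (\<Sum>j\<in>UNIV. \<bar>x $ j\<bar>)"

definition max_l1_norm :: "(real ^ 'i::finite) set \<Rightarrow> real" where
  "max_l1_norm X = (GREATEST m. m \<in> l1_norm ` X)"

text \<open>
  The recursion runs downwards from \<open>dgf_coeff blk a n n = 1\<close>; indices \<open>k > n\<close> are never used.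
\<close>

function dgf_coeff :: "('i::finite \<Rightarrow> nat) \<Rightarrow> (nat \<Rightarrow> real ^ 'i) \<Rightarrow> nat \<Rightarrow> nat \<Rightarrow> real" where
  "dgf_coeff blk a n k =
     (if k \<ge> n then 1
      else 1 + infnorm (\<Sum>p=k..n-1. (dgf_coeff blk a n (p + 1) * real (l0_norm (a p))) *\<^sub>R block blk k (a p)))"
  by pat_completeness auto
termination
  by (relation "Wellfounded.measure (\<lambda>(blk, a, n, k). n - k)") auto

declare dgf_coeff.simps [simp del]

text \<open>
  The logarithm is natural, and \<open>ln 0 = 0\<close> in HOL, so \<open>0 * ln 0 = 0\<close> as required.
\<close>

definition dilatable_global_entropy ::
    "('i::finite \<Rightarrow> nat) \<Rightarrow> (nat \<Rightarrow> nat) \<Rightarrow> (nat \<Rightarrow> real ^ 'i) \<Rightarrow> nat \<Rightarrow> real ^ 'i \<Rightarrow> real" where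
  "dilatable_global_entropy blk s a n x =
     (let \<alpha> = dgf_coeff blk a n; h = scale_fun blk a in
        (\<Sum>k=1..n. \<alpha> k * (\<Sum>j | blk j = k. x $ j * ln (x $ j)))
      - (\<Sum>k=2..n. \<alpha> k * h (k - 1) x * ln (h (k - 1) x))
      + \<alpha> 1 * ln (real (s 1))
      + (\<Sum>k=2..n. \<alpha> k * h (k - 1) x * ln (real (s k))))"

text \<open>
  \<open>X\<close> need not be full-dimensional, so the gradient of a function on \<open>X\<close> is taken within \<open>X\<close>.
  It is unique only up to vectors orthogonal to the affine hull of \<open>X\<close>, which do not
  affect the inner products below; the inequality is required of every choice of gradients.
\<close>

definition has_gradient_within ::
    "('a::euclidean_space \<Rightarrow> real) \<Rightarrow> 'a \<Rightarrow> 'a \<Rightarrow> 'a set \<Rightarrow> bool" where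
  "has_gradient_within d g x X \<longleftrightarrow> (d has_derivative (\<lambda>v. g \<bullet> v)) (at x within X)"

definition strongly_convex_wrt ::
    "real \<Rightarrow> ('a::euclidean_space \<Rightarrow> real) \<Rightarrow> 'a set \<Rightarrow> ('a \<Rightarrow> real) \<Rightarrow> bool" where
  "strongly_convex_wrt \<mu> N X d \<longleftrightarrow>
     (\<forall>x\<in>rel_interior X. \<exists>g. has_gradient_within d g x X) \<and>
     (\<forall>x\<in>rel_interior X. \<forall>x'\<in>rel_interior X. \<forall>g g'.
        has_gradient_within d g x X \<longrightarrow> has_gradient_within d g' x' X \<longrightarrow>
        (g - g') \<bullet> (x - x') \<ge> \<mu> * (N (x - x'))\<^sup>2)"

end

theory Submission imports Defs begin

text \<open>
  Write \<open>F(p, q) = (ln p - ln q)(p - q)\<close>. The gradient gap of the entropy between \<open>x\<close> and \<open>x'\<close> is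
  \<open>\<Sum>\<^sub>j \<alpha>\<^bsub>blk j\<^esub> F(x\<^sub>j, x'\<^sub>j) - \<Sum>\<^sub>k \<alpha>\<^bsub>k+1\<^esub> F(a\<^sub>k \<bullet> x, a\<^sub>k \<bullet> x')\<close>.
  As \<open>F\<close> is convex and positively homogeneous, \<open>F(a\<^sub>k \<bullet> x, a\<^sub>k \<bullet> x') \<le> \<Sum>\<^sub>j a\<^bsub>k,j\<^esub> F(x\<^sub>j, x'\<^sub>j)\<close>, and the
  recursion for \<open>\<alpha>\<close> leaves every \<open>F(x\<^sub>j, x'\<^sub>j)\<close> with total weight at least \<open>1\<close>. Finally
  \<open>F(p, q) \<ge> (p - q)\<^sup>2 / ((p + q) / 2)\<close>: for the Euclidean norm use \<open>p, q \<le> 1\<close>, for the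
  \<open>\<ell>\<^sub>1\<close> norm the Cauchy-Schwarz inequality with the weights \<open>(p + q) / 2\<close>.
\<close>

subsection \<open>The symmetrised relative entropy\<close>

text \<open>The function \<open>F\<close> of the overview. As \<open>ln t + 1\<close> is the
  derivative of \<open>t * ln t\<close>, this is the sum of the two Bregman divergences of
  \<open>t * ln t\<close> between \<open>p\<close> and \<open>q\<close>.\<close>

definition log_gap :: "real \<Rightarrow> real \<Rightarrow> real" where
  "log_gap p q = (ln p - ln q) * (p - q)"

lemma log_gap_commute: "log_gap p q = log_gap q p"
  by (simp add: log_gap_def algebra_simps)

text \<open>The bound is the [1/1] Pade approximant of \<open>ln\<close> at 1. The difference of the
  two sides vanishes at 1 and has derivative \<open>(t - 1)^2 / (t * (t + 1)^2)\<close>.\<close>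

lemma ln_ge_pade:
  fixes t :: real
  assumes "1 \<le> t"
  shows "2 * (t - 1) / (t + 1) \<le> ln t"
proof -
  let ?f = "\<lambda>t::real. ln t - 2 * (t - 1) / (t + 1)"
  have "?f 1 \<le> ?f t"
  proof (rule DERIV_nonneg_imp_nondecreasing[OF assms])
    fix u :: real assume u: "1 \<le> u" "u \<le> t"
    have "(?f has_real_derivative (1 / u - 4 / (u + 1)\<^sup>2)) (at u)"
      using u by (auto intro!: derivative_eq_intros simp: power2_eq_square field_simps)
    moreover have "0 \<le> 1 / u - 4 / (u + 1)\<^sup>2"
    proof -
      have "4 * u \<le> (u + 1)\<^sup>2"
        using zero_le_power2[of "u - 1"] by (simp add: power2_eq_square algebra_simps)
      then show ?thesis using u by (simp add: field_simps)
    qed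
    ultimately show "\<exists>y. (?f has_real_derivative y) (at u) \<and> 0 \<le> y" by blast
  qed
  then show ?thesis by simp
qed

text \<open>For distinct \<open>p\<close> and \<open>q\<close> this says that the logarithmic mean
  \<open>(p - q) / (ln p - ln q)\<close> is at most the arithmetic mean. By symmetry
  \<open>q \<le> p\<close> may be assumed, and the Pade bound is used at
  \<open>t = p / q\<close>.\<close>

lemma log_gap_ge:
  assumes "0 < p" "0 < q"
  shows "(p - q)\<^sup>2 / ((p + q) / 2) \<le> log_gap p q"
proof -
  have *: "(p - q)\<^sup>2 / ((p + q) / 2) \<le> log_gap p q" if "0 < q" "q \<le> p" for p q :: real
  proof -
    have "2 * (p / q - 1) / (p / q + 1) \<le> ln (p / q)"
      by (rule ln_ge_pade) (use that in simp)
    moreover have "p / q - 1 = (p - q) / q" "p / q + 1 = (p + q) / q"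
      using that by (simp_all add: field_simps)
    then have "2 * (p / q - 1) / (p / q + 1) = (p - q) / ((p + q) / 2)"
      using that by simp
    moreover have "ln (p / q) = ln p - ln q"
      using that by (simp add: ln_div)
    ultimately have "(p - q) / ((p + q) / 2) * (p - q) \<le> (ln p - ln q) * (p - q)"
      using that by (intro mult_right_mono) auto
    then show ?thesis by (simp add: log_gap_def power2_eq_square mult_ac)
  qed
  show ?thesis
  proof (cases "q \<le> p")
    case True
    then show ?thesis using * assms by blast
  next
    case False
    then show ?thesis
      using *[OF assms(1), of q]
      by (simp add: log_gap_commute add.commute power2_commute)
  qed
qed

lemma log_gap_nonneg: "0 < p \<Longrightarrow> 0 < q \<Longrightarrow> 0 \<le> log_gap p q"
  by (rule order_trans[OF _ log_gap_ge]) auto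

text \<open>
  The right-hand side is the tangent plane of \<open>log_gap\<close> at \<open>(P, Q)\<close>, which has no constant
  term because of homogeneity.
\<close>

lemma log_gap_ge_tangent:
  assumes "0 < p" "0 < q" "0 < P" "0 < Q"
  shows "(ln P - ln Q + 1 - Q / P) * p + (ln Q - ln P + 1 - P / Q) * q \<le> log_gap p q"
proof -
  \<comment> \<open>\<open>r\<close> compares the ratio \<open>p / q\<close> with
    \<open>P / Q\<close>. Since \<open>p / r = q * P / Q\<close> and
    \<open>q * r = p * Q / P\<close>, the cross terms change places, and right side minus left side
    becomes \<open>p * (ln r - 1 + 1 / r) + q * (r - 1 - ln r)\<close>.\<close>
  define r where "r = (p * Q) / (q * P)"
  have r: "0 < r" using assms by (simp add: r_def)
  have ln_r: "ln r = ln p + ln Q - ln q - ln P"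
    using assms by (simp add: r_def ln_div ln_mult)
  have "ln r \<le> r - 1" "ln (1 / r) \<le> 1 / r - 1"
    using r by (intro ln_le_minus_one; simp)+
  then have "0 \<le> p * (ln r - 1 + 1 / r)" "0 \<le> q * (r - 1 - ln r)"
    using assms r by (auto simp: ln_div)
  moreover have "p * (1 / r) = q * (P / Q)" "q * r = p * (Q / P)"
    using assms by (simp_all add: r_def field_simps)
  ultimately show ?thesis
    unfolding log_gap_def using ln_r by (simp add: algebra_simps)
qed

text \<open>Jensen's inequality for weights of arbitrary total. The tangent plane at the weighted
  sums \<open>(P, Q)\<close> has no constant term, so it can be summed against \<open>w\<close>
  without normalising, and at \<open>(P, Q)\<close> it touches \<open>log_gap\<close>.\<close>

lemma log_gap_sum_le:
  fixes w p q :: "'j \<Rightarrow> real"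
  assumes w: "\<And>j. j \<in> J \<Longrightarrow> 0 \<le> w j"
    and pos: "\<And>j. j \<in> J \<Longrightarrow> 0 < p j" "\<And>j. j \<in> J \<Longrightarrow> 0 < q j"
    and P: "0 < (\<Sum>j\<in>J. w j * p j)" and Q: "0 < (\<Sum>j\<in>J. w j * q j)"
  shows "log_gap (\<Sum>j\<in>J. w j * p j) (\<Sum>j\<in>J. w j * q j) \<le> (\<Sum>j\<in>J. w j * log_gap (p j) (q j))"
proof -
  define P where "P = (\<Sum>j\<in>J. w j * p j)"
  define Q where "Q = (\<Sum>j\<in>J. w j * q j)"
  define A where "A = ln P - ln Q + 1 - Q / P"
  define B where "B = ln Q - ln P + 1 - P / Q"
  have PQ: "0 < P" "0 < Q" using P Q by (simp_all add: P_def Q_def)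
  have "log_gap P Q = A * P + B * Q"
    using PQ by (simp add: log_gap_def A_def B_def algebra_simps)
  also have "\<dots> = (\<Sum>j\<in>J. w j * (A * p j + B * q j))"
    by (simp add: P_def Q_def sum_distrib_left sum.distrib algebra_simps)
  also have "\<dots> \<le> (\<Sum>j\<in>J. w j * log_gap (p j) (q j))"
    unfolding A_def B_def
    by (intro sum_mono mult_left_mono log_gap_ge_tangent w pos PQ)
  finally show ?thesis by (simp add: P_def Q_def)
qed

subsection \<open>Gradients on convex sets\<close>

text \<open>If \<open>X\<close> is not full-dimensional, derivatives within \<open>X\<close> may
  differ off its affine hull. Along the segment from \<open>x\<close> to \<open>y\<close> each of
  them gives the one-sided derivative at 0 of a function of one variable, which is unique.\<close>

lemma has_derivative_within_convex_unique:
  fixes f :: "'a::real_normed_vector \<Rightarrow> real"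
  assumes "convex X" "x \<in> X" "y \<in> X"
    and D: "(f has_derivative D) (at x within X)" and E: "(f has_derivative E) (at x within X)"
  shows "D (y - x) = E (y - x)"
proof -
  let ?l = "\<lambda>t::real. x + t *\<^sub>R (y - x)"
  have sub: "?l ` {0..1} \<subseteq> X"
  proof
    fix z assume "z \<in> ?l ` {0..1}"
    then obtain t where t: "0 \<le> t" "t \<le> 1" "z = ?l t" by auto
    then have "z = (1 - t) *\<^sub>R x + t *\<^sub>R y" by (simp add: algebra_simps)
    then show "z \<in> X" using convexD_alt[OF assms(1-3) t(1,2)] by simp
  qed
  have l: "(?l has_derivative (\<lambda>t. t *\<^sub>R (y - x))) (at 0 within {0..1})"
    by (auto intro!: derivative_eq_intros)
  have *: "((f \<circ> ?l) has_vector_derivative G (y - x)) (at 0 within {0..1})"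
    if G: "(f has_derivative G) (at x within X)" for G
  proof -
    have "(f has_derivative G) (at (?l 0) within ?l ` {0..1})"
      using has_derivative_subset[OF G sub] by simp
    from diff_chain_within[OF l this]
    have "((f \<circ> ?l) has_derivative (G \<circ> (\<lambda>t. t *\<^sub>R (y - x)))) (at 0 within {0..1})" .
    moreover have "G \<circ> (\<lambda>t. t *\<^sub>R (y - x)) = (\<lambda>t. t *\<^sub>R G (y - x))"
      using has_derivative_linear[OF G] by (auto simp: linear_cmul)
    ultimately show ?thesis by (simp add: has_vector_derivative_def)
  qed
  show ?thesis
    by (rule vector_derivative_unique_within_closed_interval[of 0 1 0 "f \<circ> ?l"])
      (use *[OF D] *[OF E] in auto)
qed

text \<open>The definition quantifies over all gradients. They agree with any one derivative
  \<open>D\<close> on the directions that occur, so it suffices to check the inequality for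
  \<open>D\<close>.\<close>

lemma strongly_convex_wrtI:
  fixes X :: "'a::euclidean_space set"
  assumes "convex X"
    and D: "\<And>x. x \<in> rel_interior X \<Longrightarrow> (d has_derivative D x) (at x within X)"
    and mono: "\<And>x y. x \<in> rel_interior X \<Longrightarrow> y \<in> rel_interior X \<Longrightarrow>
       \<mu> * (N (x - y))\<^sup>2 \<le> D x (x - y) - D y (x - y)"
  shows "strongly_convex_wrt \<mu> N X d"
  unfolding strongly_convex_wrt_def
proof (intro conjI ballI allI impI)
  fix x assume x: "x \<in> rel_interior X"
  \<comment> \<open>The Riesz vector of the functional \<open>D x\<close> is its adjoint applied to
    1.\<close>
  have "D x = (\<lambda>v. adjoint (D x) 1 \<bullet> v)"
    using adjoint_works[OF has_derivative_linear[OF D[OF x]], of _ 1]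
    by (simp add: fun_eq_iff inner_commute)
  then show "\<exists>g. has_gradient_within d g x X"
    using D[OF x] unfolding has_gradient_within_def by metis
next
  fix x y g g'
  assume x: "x \<in> rel_interior X" and y: "y \<in> rel_interior X"
    and g: "has_gradient_within d g x X" and g': "has_gradient_within d g' y X"
  have X: "x \<in> X" "y \<in> X" using x y rel_interior_subset by auto
  \<comment> \<open>Uniqueness covers only directions from the base point to a point of
    \<open>X\<close>: \<open>y - x\<close> at \<open>x\<close>, but \<open>x - y\<close> at
    \<open>y\<close>. Hence the change of sign below.\<close>
  have "g \<bullet> (y - x) = D x (y - x)"
    using has_derivative_within_convex_unique[OF \<open>convex X\<close> X g[unfolded has_gradient_within_def] D[OF x]] .
  moreover have "D x (y - x) = - D x (x - y)"
    using linear_neg[OF has_derivative_linear[OF D[OF x]], of "x - y"] by simp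
  ultimately have "g \<bullet> (x - y) = D x (x - y)"
    by (simp add: inner_diff_right)
  moreover have "g' \<bullet> (x - y) = D y (x - y)"
    using has_derivative_within_convex_unique[OF \<open>convex X\<close> X(2,1) g'[unfolded has_gradient_within_def] D[OF y]] .
  ultimately show "(g - g') \<bullet> (x - y) \<ge> \<mu> * (N (x - y))\<^sup>2"
    using mono[OF x y] by (simp add: inner_diff_left)
qed

text \<open>The segment from \<open>w\<close> to \<open>x\<close> can be prolonged a little beyond
  \<open>x\<close> inside \<open>X\<close>. If \<open>x $ j\<close> were not positive, the prolonged
  point would have a negative coordinate \<open>j\<close>.\<close>

lemma rel_interior_component_pos:
  fixes X :: "(real ^ 'i::finite) set"
  assumes "convex X" "x \<in> rel_interior X"
    and nonneg: "\<And>y. y \<in> X \<Longrightarrow> 0 \<le> y $ j" and w: "w \<in> X" "0 < w $ j"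
  shows "0 < x $ j"
proof -
  obtain e where e: "1 < e" "(1 - e) *\<^sub>R w + e *\<^sub>R x \<in> X"
    using convex_rel_interior_iff[of X x] assms by blast
  have "0 < (e - 1) * w $ j" using e w by simp
  also have "\<dots> \<le> e * x $ j" using nonneg[OF e(2)] by (simp add: algebra_simps)
  finally show ?thesis using e by (simp add: zero_less_mult_iff)
qed

lemma has_derivative_mult_ln_self:
  fixes f :: "'a::real_normed_vector \<Rightarrow> real"
  assumes "(f has_derivative f') (at x within X)" "0 < f x"
  shows "((\<lambda>x. f x * ln (f x)) has_derivative (\<lambda>v. f' v * (ln (f x) + 1))) (at x within X)"
proof -
  have "((\<lambda>x. f x * ln (f x)) has_derivative (\<lambda>v. f x * (f' v * inverse (f x)) + f' v * ln (f x))) (at x within X)"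
    using assms by (intro has_derivative_mult has_derivative_ln)
  then show ?thesis
    by (rule has_derivative_eq_rhs) (use assms(2) in \<open>simp add: fun_eq_iff algebra_simps\<close>)
qed

lemma sum_by_blocks:
  fixes blk :: "'i::finite \<Rightarrow> nat" and f :: "nat \<Rightarrow> 'i \<Rightarrow> real"
  assumes "\<And>j. blk j \<in> {1..n}"
  shows "(\<Sum>k=1..n. \<Sum>j | blk j = k. f k j) = (\<Sum>j\<in>UNIV. f (blk j) j)"
proof -
  have "(\<Sum>k=1..n. \<Sum>j | blk j = k. f k j) = (\<Sum>k=1..n. \<Sum>j | j \<in> UNIV \<and> blk j = k. f (blk j) j)"
    by (intro sum.cong) auto
  also have "\<dots> = (\<Sum>j\<in>UNIV. f (blk j) j)"
    using assms by (intro sum.group) auto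
  finally show ?thesis .
qed

subsection \<open>Chains of simplices\<close>

text \<open>The chain described by linear constraints: the factor that scales block
  \<open>Suc m\<close> can be read off as the sum of that block. Convexity and closedness are
  evident in this form, unlike for the products \<open>h u *\<^sub>R v\<close>.\<close>

definition chain_polytope :: "('i::finite \<Rightarrow> nat) \<Rightarrow> (nat \<Rightarrow> real ^ 'i) \<Rightarrow> nat \<Rightarrow> (real ^ 'i) set" where
  "chain_polytope blk a k =
     {x. (\<forall>j. 0 \<le> x $ j) \<and> (\<forall>j. k < blk j \<longrightarrow> x $ j = 0) \<and> (\<Sum>j | blk j = 1. x $ j) = 1 \<and>
         (\<forall>m\<in>{1..<k}. (\<Sum>j | blk j = Suc m. x $ j) = a m \<bullet> x)}"

lemma convex_chain_polytope: "convex (chain_polytope blk a k)"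
  unfolding convex_def chain_polytope_def
  by (auto simp: sum.distrib inner_add_right simp flip: sum_distrib_left)

lemma closed_chain_polytope: "closed (chain_polytope blk a k)"
  unfolding chain_polytope_def Ball_def
  by (intro closed_Collect_conj closed_Collect_all closed_Collect_le closed_Collect_eq
      closed_Collect_imp open_Collect_const continuous_intros)

locale simplex_chain_data =
  fixes n :: nat and s :: "nat \<Rightarrow> nat" and blk :: "'i::finite \<Rightarrow> nat" and a :: "nat \<Rightarrow> real ^ 'i"
  assumes n: "1 \<le> n"
    and blk: "\<And>j. blk j \<in> {1..n}"
    and block_nonempty: "\<And>k. k \<in> {1..n} \<Longrightarrow> {j. blk j = k} \<noteq> {}"
    and a_bounds: "\<And>k j. k \<in> {1..<n} \<Longrightarrow> 0 \<le> a k $ j"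
    and a_zero: "\<And>k j. k \<in> {1..<n} \<Longrightarrow> k < blk j \<Longrightarrow> a k $ j = 0"
    and scale_nonneg: "\<And>k u. k \<in> {1..<n} \<Longrightarrow> u \<in> simplex_chain blk a k \<Longrightarrow> 0 \<le> scale_fun blk a k u"
    and scale_pos: "\<And>k u. k \<in> {1..<n} \<Longrightarrow> u \<in> rel_interior (simplex_chain blk a k) \<Longrightarrow> 0 < scale_fun blk a k u"
    and scale_le_1: "\<And>k u. k \<in> {1..<n} \<Longrightarrow> u \<in> simplex_chain blk a k \<Longrightarrow> scale_fun blk a k u \<le> 1"
begin

section \<open>The chain of scaled extensions equals the polytope\<close>

lemma scale_fun_eq_inner:
  assumes k: "k \<in> {1..<n}"
  shows "scale_fun blk a k u = a k \<bullet> u"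
proof -
  have "scale_fun blk a k u = (\<Sum>m=1..k. \<Sum>j\<in>UNIV. if blk j = m then a k $ j * u $ j else 0)"
    unfolding scale_fun_def inner_vec_def block_def by (intro sum.cong) auto
  also have "\<dots> = (\<Sum>j\<in>UNIV. \<Sum>m=1..k. if blk j = m then a k $ j * u $ j else 0)"
    by (rule sum.swap)
  also have "\<dots> = (\<Sum>j\<in>UNIV. a k $ j * u $ j)"
  proof (intro sum.cong refl)
    fix j
    show "(\<Sum>m=1..k. if blk j = m then a k $ j * u $ j else 0) = a k $ j * u $ j"
      using blk[of j] a_zero[OF k, of j] by (cases "blk j \<le> k") (auto simp: sum.delta)
  qed
  finally show ?thesis by (simp add: inner_vec_def)
qed

lemma inner_a_cong:
  assumes "m \<in> {1..<n}" "\<And>j. blk j \<le> m \<Longrightarrow> x $ j = y $ j"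
  shows "a m \<bullet> x = a m \<bullet> y"
  unfolding inner_vec_def
  using assms a_zero[OF assms(1)] by (intro sum.cong refl) (metis inner_real_def mult_zero_left not_le)

text \<open>By induction on the number of blocks. Appending a scaled simplex point adds exactly the
  constraint on the sum of the new block; conversely, the last block is cut off and divided by its
  sum.\<close>

lemma simplex_chain_eq_polytope:
  assumes "k \<in> {1..n}"
  shows "simplex_chain blk a k = chain_polytope blk a k"
  using assms
proof (induction k)
  case 0
  then show ?case by simp
next
  case (Suc k)
  show ?case
  proof (cases "k = 0")
    case True
    have "block_simplex blk 1 = chain_polytope blk a 1"
    proof -
      have "blk j \<noteq> 1 \<longleftrightarrow> 1 < blk j" for j using blk[of j] by auto
      then show ?thesis by (simp add: block_simplex_def chain_polytope_def)
    qed
    then show ?thesis using True by (simp add: simplex_chain_def)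
  next
    case False
    then have k: "k \<in> {1..<n}" "k \<in> {1..n}" using Suc.prems by auto
    have step: "simplex_chain blk a (Suc k) =
        scaled_ext (chain_polytope blk a k) (\<lambda>u. a k \<bullet> u) (block_simplex blk (Suc k))"
      using False Suc.IH[OF k(2)] scale_fun_eq_inner[OF k(1), abs_def]
      by (cases k) (simp_all add: simplex_chain_def)
    show ?thesis
    proof (intro equalityI subsetI)
      fix x assume "x \<in> simplex_chain blk a (Suc k)"
      then obtain u v where x: "x = u + (a k \<bullet> u) *\<^sub>R v" and u: "u \<in> chain_polytope blk a k"
        and v: "v \<in> block_simplex blk (Suc k)"
        unfolding step scaled_ext_def by blast
      have h: "0 \<le> a k \<bullet> u"
        using scale_nonneg[OF k(1)] u Suc.IH[OF k(2)] scale_fun_eq_inner[OF k(1)] by simp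
      have u0: "u $ j = 0" if "k < blk j" for j using u that by (simp add: chain_polytope_def)
      have v0: "v $ j = 0" if "blk j \<noteq> Suc k" for j using v that by (simp add: block_simplex_def)
      have xu: "x $ j = u $ j" if "blk j \<le> k" for j using v0[of j] that by (simp add: x)
      have ax: "a m \<bullet> x = a m \<bullet> u" if "m \<in> {1..k}" for m
        using that k by (intro inner_a_cong xu) auto
      have "(\<Sum>j | blk j = Suc m. x $ j) = a m \<bullet> x" if m: "m \<in> {1..<Suc k}" for m
      proof (cases "m = k")
        case True
        have "(\<Sum>j | blk j = Suc k. x $ j) = (\<Sum>j | blk j = Suc k. (a k \<bullet> u) * v $ j)"
          by (intro sum.cong) (auto simp: x u0)
        also have "\<dots> = a k \<bullet> u"
          using v by (simp add: block_simplex_def flip: sum_distrib_left)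
        finally show ?thesis using True ax k by simp
      next
        case False
        then have "(\<Sum>j | blk j = Suc m. x $ j) = (\<Sum>j | blk j = Suc m. u $ j)"
          using m by (intro sum.cong) (auto simp: xu)
        also have "\<dots> = a m \<bullet> u" using u m False by (simp add: chain_polytope_def)
        finally show ?thesis using ax[of m] m by simp
      qed
      moreover have "(\<Sum>j | blk j = 1. x $ j) = (\<Sum>j | blk j = 1. u $ j)"
        using k by (intro sum.cong) (auto simp: xu)
      moreover have "0 \<le> x $ j" for j
        using u v h by (simp add: x chain_polytope_def block_simplex_def)
      ultimately show "x \<in> chain_polytope blk a (Suc k)"
        using u by (simp add: chain_polytope_def) (simp add: x u0 v0)
    next
      fix x assume x: "x \<in> chain_polytope blk a (Suc k)"
      define u :: "real ^ 'i" where "u = (\<chi> j. if blk j \<le> k then x $ j else 0)"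
      define w :: "real ^ 'i" where "w = block blk (Suc k) x"
      have xuw: "x = u + w"
        using x by (auto simp: vec_eq_iff u_def w_def block_def chain_polytope_def)
      have au: "a m \<bullet> u = a m \<bullet> x" if "m \<in> {1..k}" for m
        using that k by (intro inner_a_cong) (auto simp: u_def)
      have sum_u: "(\<Sum>j | blk j = m. u $ j) = (\<Sum>j | blk j = m. x $ j)" if "m \<le> k" for m
        using that by (intro sum.cong) (auto simp: u_def)
      have u: "u \<in> chain_polytope blk a k"
        using x k sum_u au
        by (simp add: chain_polytope_def) (simp add: u_def)
      have sum_w: "(\<Sum>j | blk j = Suc k. w $ j) = a k \<bullet> u"
        using x k au[of k] by (simp add: chain_polytope_def w_def block_def)
      have w0: "0 \<le> w $ j" for j using x by (simp add: w_def block_def chain_polytope_def)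
      have w1: "w $ j = 0" if "blk j \<noteq> Suc k" for j using that by (simp add: w_def block_def)
      \<comment> \<open>If the scaling factor is 0, the nonnegative block \<open>w\<close> sums to 0
        and so vanishes; then any point of the simplex serves, here a vertex. Otherwise
        \<open>w\<close> is normalised.\<close>
      obtain v where v: "v \<in> block_simplex blk (Suc k)" "w = (a k \<bullet> u) *\<^sub>R v"
      proof (cases "a k \<bullet> u = 0")
        case True
        obtain i where i: "blk i = Suc k" using block_nonempty[OF Suc.prems] by blast
        have "axis i 1 \<in> block_simplex blk (Suc k)"
          using i by (auto simp: block_simplex_def axis_def)
        moreover have "w $ j = 0" for j
        proof (cases "blk j = Suc k")
          case True
          then show ?thesis
            using sum_nonneg_eq_0_iff[of "{j. blk j = Suc k}" "\<lambda>j. w $ j"] sum_w w0 \<open>a k \<bullet> u = 0\<close> by auto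
        qed (rule w1)
        then have "w = 0" by (simp add: vec_eq_iff)
        ultimately show ?thesis using that True by simp
      next
        case False
        have "0 \<le> a k \<bullet> u" unfolding sum_w[symmetric] using w0 by (simp add: sum_nonneg)
        then have "(1 / (a k \<bullet> u)) *\<^sub>R w \<in> block_simplex blk (Suc k)"
          using False w0 w1 sum_w by (simp add: block_simplex_def flip: sum_divide_distrib)
        then show ?thesis using False by (intro that) auto
      qed
      show "x \<in> simplex_chain blk a (Suc k)"
        unfolding step scaled_ext_def using xuw u v by blast
    qed
  qed
qed

section \<open>Bounds on coordinates, compactness, and a positive point\<close>

lemma chain_polytope_truncate:
  assumes "x \<in> chain_polytope blk a n" "k \<in> {1..n}"
  shows "(\<chi> j. if blk j \<le> k then x $ j else 0) \<in> chain_polytope blk a k" (is "?u \<in> _")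
proof -
  have "a m \<bullet> ?u = a m \<bullet> x" if "m \<in> {1..<k}" for m
    using that assms by (intro inner_a_cong) auto
  moreover have "(\<Sum>j | blk j = m. ?u $ j) = (\<Sum>j | blk j = m. x $ j)" if "m \<le> k" for m
    using that by (intro sum.cong) auto
  ultimately show ?thesis
    using assms by (simp add: chain_polytope_def)
qed

text \<open>The sum of block \<open>Suc m\<close> is the value of the scaling function
  \<open>m\<close>. Its bound by 1 is assumed only on the shorter chain, hence the truncation of
  \<open>x\<close>.\<close>

lemma block_sum_le_1:
  assumes x: "x \<in> chain_polytope blk a n" and k: "k \<in> {1..n}"
  shows "(\<Sum>j | blk j = k. x $ j) \<le> 1"
proof (cases "k = 1")
  case True
  then show ?thesis using x by (simp add: chain_polytope_def)
next
  case False
  define m where "m = k - 1"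
  define u :: "real ^ 'i" where "u = (\<chi> j. if blk j \<le> m then x $ j else 0)"
  have m: "k = Suc m" "m \<in> {1..<n}" "m \<in> {1..n}" using False k by (auto simp: m_def)
  have "u \<in> chain_polytope blk a m"
    unfolding u_def using chain_polytope_truncate[OF x m(3)] .
  then have "a m \<bullet> u \<le> 1"
    using scale_le_1[OF m(2)] simplex_chain_eq_polytope[OF m(3)] scale_fun_eq_inner[OF m(2)] by simp
  moreover have "a m \<bullet> u = a m \<bullet> x"
    using m by (intro inner_a_cong) (auto simp: u_def)
  ultimately show ?thesis using x m by (simp add: chain_polytope_def)
qed

lemma chain_polytope_component_le_1:
  assumes x: "x \<in> chain_polytope blk a n"
  shows "x $ j \<le> 1"
proof -
  have "x $ j \<le> (\<Sum>i | blk i = blk j. x $ i)"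
    using x by (intro member_le_sum) (auto simp: chain_polytope_def)
  then show ?thesis using block_sum_le_1[OF x blk[of j]] by simp
qed

lemma compact_chain_polytope: "compact (chain_polytope blk a n)"
  unfolding compact_eq_bounded_closed
proof
  show "bounded (chain_polytope blk a n)"
    unfolding bounded_iff
  proof (intro exI ballI)
    fix x assume x: "x \<in> chain_polytope blk a n"
    have "norm x \<le> (\<Sum>j\<in>UNIV. \<bar>x $ j\<bar>)" by (rule norm_le_l1_cart)
    also have "\<dots> \<le> (\<Sum>j\<in>(UNIV::'i set). 1)"
      using x chain_polytope_component_le_1[OF x]
      by (intro sum_mono) (simp add: chain_polytope_def)
    finally show "norm x \<le> (\<Sum>j\<in>(UNIV::'i set). 1)" .
  qed
qed (rule closed_chain_polytope)

text \<open>Such a point is the witness \<open>w\<close> that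
  \<open>rel_interior_component_pos\<close> asks for. It is built block by block, each time
  appending a positive multiple of the uniform distribution.\<close>

lemma chain_polytope_pos_point:
  assumes "k \<in> {1..n}"
  shows "\<exists>w \<in> chain_polytope blk a k. \<forall>j. blk j \<le> k \<longrightarrow> 0 < w $ j"
  using assms
proof (induction k)
  case 0
  then show ?case by simp
next
  case (Suc k)
  define c where "c = real (card {j. blk j = Suc k})"
  have c: "0 < c" using block_nonempty[OF Suc.prems] by (simp add: c_def card_gt_0_iff)
  define v :: "real ^ 'i" where "v = (\<chi> j. if blk j = Suc k then 1 / c else 0)"
  have v: "v \<in> block_simplex blk (Suc k)"
    using c block_nonempty[OF Suc.prems] by (auto simp: v_def block_simplex_def c_def)
  show ?case
  proof (cases "k = 0")
    case True
    have "v \<in> chain_polytope blk a 1"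
      using v True simplex_chain_eq_polytope[OF Suc.prems] by (simp add: simplex_chain_def)
    moreover have "\<forall>j. blk j \<le> 1 \<longrightarrow> 0 < v $ j"
    proof (intro allI impI)
      fix j assume "blk j \<le> 1"
      then have "blk j = Suc k" using blk[of j] True by auto
      then show "0 < v $ j" using c by (simp add: v_def)
    qed
    ultimately show ?thesis using True by auto
  next
    case False
    then have k: "k \<in> {1..<n}" "k \<in> {1..n}" using Suc.prems by auto
    obtain w where w: "w \<in> chain_polytope blk a k" "\<And>j. blk j \<le> k \<Longrightarrow> 0 < w $ j"
      using Suc.IH[OF k(2)] by blast
    \<comment> \<open>The scaling function is assumed positive only on the relative interior, so
      \<open>w\<close> is replaced by a relative interior point \<open>u\<close>; the existence of
      \<open>w\<close> makes the coordinates of \<open>u\<close> positive as well.\<close>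
    obtain u where u: "u \<in> rel_interior (chain_polytope blk a k)"
      using rel_interior_eq_empty[OF convex_chain_polytope] w(1) by blast
    have u': "u \<in> chain_polytope blk a k" using u rel_interior_subset by blast
    have u_pos: "0 < u $ j" if "blk j \<le> k" for j
      using rel_interior_component_pos[OF convex_chain_polytope u _ w(1) w(2)[OF that]]
      by (simp add: chain_polytope_def)
    define h where "h = scale_fun blk a k u"
    have h: "0 < h"
      unfolding h_def using scale_pos[OF k(1)] u simplex_chain_eq_polytope[OF k(2)] by simp
    have "simplex_chain blk a (Suc k) =
        scaled_ext (simplex_chain blk a k) (scale_fun blk a k) (block_simplex blk (Suc k))"
      using False by (cases k) (simp_all add: simplex_chain_def)
    then have "u + h *\<^sub>R v \<in> chain_polytope blk a (Suc k)"
      using u' v simplex_chain_eq_polytope[OF k(2)] simplex_chain_eq_polytope[OF Suc.prems]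
      unfolding scaled_ext_def h_def by blast
    moreover have "0 < (u + h *\<^sub>R v) $ j" if "blk j \<le> Suc k" for j
    proof (cases "blk j = Suc k")
      case True
      then show ?thesis using c h u' by (simp add: v_def chain_polytope_def)
    next
      case False
      then show ?thesis using u_pos[of j] that by (simp add: v_def)
    qed
    ultimately show ?thesis by blast
  qed
qed

section \<open>Positivity on the relative interior and the maximal norm\<close>

abbreviation X :: "(real ^ 'i) set" where "X \<equiv> chain_polytope blk a n"

lemma rel_interior_pos:
  assumes "x \<in> rel_interior X"
  shows "0 < x $ j"
proof -
  obtain w where "w \<in> X" "0 < w $ j"
    using chain_polytope_pos_point[of n] n blk[of j] by auto
  then show ?thesis
    by (intro rel_interior_component_pos[OF convex_chain_polytope assms]) (auto simp: chain_polytope_def)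
qed

text \<open>No comparison of the relative interiors of the chain and its truncations is made:
  \<open>a k \<bullet> x\<close> is the sum of the nonempty block \<open>Suc k\<close>, whose
  entries are positive.\<close>

lemma rel_interior_inner_pos:
  assumes x: "x \<in> rel_interior X" and k: "k \<in> {1..<n}"
  shows "0 < a k \<bullet> x"
proof -
  have "0 < (\<Sum>j | blk j = Suc k. x $ j)"
    using block_nonempty[of "Suc k"] k rel_interior_pos[OF x] by (intro sum_pos) auto
  then show ?thesis
    using x k rel_interior_subset[of X] by (auto simp: chain_polytope_def)
qed

text \<open>Compactness makes the maximum attained, which gives \<open>GREATEST\<close> its intended
  value.\<close>

lemma l1_norm_le_max:
  assumes "x \<in> X"
  shows "l1_norm x \<le> max_l1_norm X"
proof -
  have "continuous_on X l1_norm"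
    unfolding l1_norm_def by (intro continuous_intros)
  then obtain y where y: "y \<in> X" "\<And>z. z \<in> X \<Longrightarrow> l1_norm z \<le> l1_norm y"
    using continuous_attains_sup[OF compact_chain_polytope] assms by blast
  have "max_l1_norm X = l1_norm y"
    unfolding max_l1_norm_def using y by (intro Greatest_equality) auto
  then show ?thesis using y(2)[OF assms] by simp
qed

subsection \<open>The coefficients and the gradient of the entropy\<close>

abbreviation \<alpha> :: "nat \<Rightarrow> real" where "\<alpha> \<equiv> dgf_coeff blk a n"

lemma coeff_ge_1: "1 \<le> \<alpha> k"
  by (subst dgf_coeff.simps) (simp add: infnorm_pos_le)

text \<open>The weight of coordinate \<open>j\<close> pays for every scaling function in which
  \<open>j\<close> occurs and leaves 1 over. Only \<open>p\<close> with \<open>blk j \<le> p\<close>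
  contribute, by the zero padding of \<open>a p\<close>, and a coordinate is at most the
  \<open>infnorm\<close>.\<close>

lemma coeff_ge: "1 + (\<Sum>p=1..<n. \<alpha> (Suc p) * a p $ j) \<le> \<alpha> (blk j)"
proof -
  let ?k = "blk j"
  have "(\<Sum>p=1..<n. \<alpha> (Suc p) * a p $ j) = (\<Sum>p=?k..<n. \<alpha> (Suc p) * a p $ j)"
    using blk[of j] by (intro sum.mono_neutral_right) (auto simp: a_zero)
  also have "1 + \<dots> \<le> \<alpha> ?k"
  proof (cases "n \<le> ?k")
    case True
    then show ?thesis by (simp add: coeff_ge_1)
  next
    case False
    define V where "V = (\<Sum>p=?k..n-1. (\<alpha> (p + 1) * real (l0_norm (a p))) *\<^sub>R block blk ?k (a p))"
    have "(\<Sum>p=?k..<n. \<alpha> (Suc p) * a p $ j) \<le> (\<Sum>p=?k..<n. \<alpha> (Suc p) * real (l0_norm (a p)) * a p $ j)"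
    proof (rule sum_mono)
      fix p assume p: "p \<in> {?k..<n}"
      then have p': "p \<in> {1..<n}" using blk[of j] by auto
      show "\<alpha> (Suc p) * a p $ j \<le> \<alpha> (Suc p) * real (l0_norm (a p)) * a p $ j"
      \<comment> \<open>A nonzero entry at \<open>j\<close> forces \<open>l0_norm (a p)\<close> to
        be at least 1.\<close>
      proof (cases "a p $ j = 0")
        case False
        then have "1 \<le> l0_norm (a p)"
          unfolding l0_norm_def by (auto simp: Suc_le_eq card_gt_0_iff)
        then have "\<alpha> (Suc p) * 1 \<le> \<alpha> (Suc p) * real (l0_norm (a p))"
          using coeff_ge_1[of "Suc p"] by (intro mult_left_mono) auto
        then show ?thesis using a_bounds[OF p', of j] by (intro mult_right_mono) auto
      qed simp
    qed
    also have "\<dots> = V $ j"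
      unfolding V_def using n by (simp add: block_def) (intro sum.cong, auto)
    also have "\<dots> \<le> infnorm V"
      using component_le_infnorm_cart[of V j] by simp
    finally show ?thesis
      using False by (subst dgf_coeff.simps) (simp add: V_def)
  qed
  finally show ?thesis by simp
qed

definition entropy_deriv :: "real ^ 'i \<Rightarrow> real ^ 'i \<Rightarrow> real" where
  "entropy_deriv x v =
     (\<Sum>k=1..n. \<alpha> k * (\<Sum>j | blk j = k. v $ j * (ln (x $ j) + 1)))
     - (\<Sum>k=2..n. \<alpha> k * ((a (k - 1) \<bullet> v) * (ln (a (k - 1) \<bullet> x) + 1)))
     + (\<Sum>k=2..n. \<alpha> k * (a (k - 1) \<bullet> v) * ln (real (s k)))"

lemma dilatable_global_entropy_eq:
  "dilatable_global_entropy blk s a n x =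
     (\<Sum>k=1..n. \<alpha> k * (\<Sum>j | blk j = k. x $ j * ln (x $ j)))
     - (\<Sum>k=2..n. \<alpha> k * ((a (k - 1) \<bullet> x) * ln (a (k - 1) \<bullet> x)))
     + \<alpha> 1 * ln (real (s 1))
     + (\<Sum>k=2..n. \<alpha> k * (a (k - 1) \<bullet> x) * ln (real (s k)))"
proof -
  have "scale_fun blk a (k - 1) x = a (k - 1) \<bullet> x" if "k \<in> {2..n}" for k
    using that by (intro scale_fun_eq_inner) auto
  then show ?thesis
    by (simp add: dilatable_global_entropy_def Let_def mult.assoc)
qed

text \<open>On the relative interior every argument of \<open>ln\<close> that depends on the point
  is positive, so each term \<open>t * ln t\<close> is differentiable there.\<close>

lemma has_derivative_entropy:
  assumes x: "x \<in> rel_interior X"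
  shows "(dilatable_global_entropy blk s a n has_derivative entropy_deriv x) (at x within X)"
proof -
  have 1: "((\<lambda>x. x $ j * ln (x $ j)) has_derivative (\<lambda>v. v $ j * (ln (x $ j) + 1))) (at x within X)" for j
    using rel_interior_pos[OF x]
    by (intro has_derivative_mult_ln_self bounded_linear_imp_has_derivative bounded_linear_vec_nth) auto
  have 2: "((\<lambda>x. (a (k - 1) \<bullet> x) * ln (a (k - 1) \<bullet> x)) has_derivative
      (\<lambda>v. (a (k - 1) \<bullet> v) * (ln (a (k - 1) \<bullet> x) + 1))) (at x within X)" if "k \<in> {2..n}" for k
  proof (intro has_derivative_mult_ln_self bounded_linear_imp_has_derivative bounded_linear_inner_right)
    show "0 < a (k - 1) \<bullet> x" using that by (intro rel_interior_inner_pos[OF x]) auto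
  qed
  have 3: "((\<lambda>x. \<alpha> k * (a (k - 1) \<bullet> x) * ln (real (s k))) has_derivative
      (\<lambda>v. \<alpha> k * (a (k - 1) \<bullet> v) * ln (real (s k)))) (at x within X)" for k
    by (auto intro!: derivative_eq_intros)
  have "((\<lambda>x. (\<Sum>k=1..n. \<alpha> k * (\<Sum>j | blk j = k. x $ j * ln (x $ j)))
     - (\<Sum>k=2..n. \<alpha> k * ((a (k - 1) \<bullet> x) * ln (a (k - 1) \<bullet> x)))
     + \<alpha> 1 * ln (real (s 1))
     + (\<Sum>k=2..n. \<alpha> k * (a (k - 1) \<bullet> x) * ln (real (s k)))) has_derivative
     (\<lambda>v. (\<Sum>k=1..n. \<alpha> k * (\<Sum>j | blk j = k. v $ j * (ln (x $ j) + 1)))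
     - (\<Sum>k=2..n. \<alpha> k * ((a (k - 1) \<bullet> v) * (ln (a (k - 1) \<bullet> x) + 1)))
     + 0
     + (\<Sum>k=2..n. \<alpha> k * (a (k - 1) \<bullet> v) * ln (real (s k))))) (at x within X)"
    by (intro has_derivative_add has_derivative_diff has_derivative_sum has_derivative_mult_right
        has_derivative_const 1 2 3)
  then show ?thesis
    by (simp add: dilatable_global_entropy_eq[abs_def] entropy_deriv_def[abs_def])
qed

text \<open>The summands \<open>+ 1\<close> and the terms with \<open>ln (real (s k))\<close> do not
  depend on the base point and cancel; only differences of logarithms remain.\<close>

lemma entropy_deriv_gap:
  "entropy_deriv x (x - y) - entropy_deriv y (x - y) =
     (\<Sum>j\<in>UNIV. \<alpha> (blk j) * log_gap (x $ j) (y $ j))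
     - (\<Sum>p=1..<n. \<alpha> (Suc p) * log_gap (a p \<bullet> x) (a p \<bullet> y))"
proof -
  have "(\<Sum>k=1..n. \<alpha> k * (\<Sum>j | blk j = k. (x - y) $ j * (ln (x $ j) + 1)))
      - (\<Sum>k=1..n. \<alpha> k * (\<Sum>j | blk j = k. (x - y) $ j * (ln (y $ j) + 1)))
      = (\<Sum>k=1..n. \<Sum>j | blk j = k. \<alpha> k * log_gap (x $ j) (y $ j))"
    unfolding sum_subtractf[symmetric] right_diff_distrib[symmetric] sum_distrib_left
    by (intro sum.cong refl) (simp add: log_gap_def algebra_simps)
  also have "\<dots> = (\<Sum>j\<in>UNIV. \<alpha> (blk j) * log_gap (x $ j) (y $ j))"
    using blk by (rule sum_by_blocks)
  finally have 1: "(\<Sum>k=1..n. \<alpha> k * (\<Sum>j | blk j = k. (x - y) $ j * (ln (x $ j) + 1)))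
      - (\<Sum>k=1..n. \<alpha> k * (\<Sum>j | blk j = k. (x - y) $ j * (ln (y $ j) + 1)))
      = (\<Sum>j\<in>UNIV. \<alpha> (blk j) * log_gap (x $ j) (y $ j))" .
  have "(\<Sum>k=2..n. \<alpha> k * ((a (k - 1) \<bullet> (x - y)) * (ln (a (k - 1) \<bullet> x) + 1)))
      - (\<Sum>k=2..n. \<alpha> k * ((a (k - 1) \<bullet> (x - y)) * (ln (a (k - 1) \<bullet> y) + 1)))
      = (\<Sum>k=2..n. \<alpha> k * log_gap (a (k - 1) \<bullet> x) (a (k - 1) \<bullet> y))"
    unfolding sum_subtractf[symmetric]
    by (intro sum.cong refl) (simp add: log_gap_def inner_diff_right algebra_simps)
  also have "\<dots> = (\<Sum>p=1..<n. \<alpha> (Suc p) * log_gap (a p \<bullet> x) (a p \<bullet> y))"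
    by (rule sum.reindex_bij_witness[of _ Suc "\<lambda>k. k - 1"]) auto
  finally show ?thesis
    using 1 unfolding entropy_deriv_def by linarith
qed

section \<open>Lower bounds for the gradient gap\<close>

lemma entropy_deriv_gap_ge:
  assumes x: "x \<in> rel_interior X" and y: "y \<in> rel_interior X"
  shows "(\<Sum>j\<in>UNIV. (x $ j - y $ j)\<^sup>2 / ((x $ j + y $ j) / 2))
    \<le> entropy_deriv x (x - y) - entropy_deriv y (x - y)"
proof -
  let ?F = "\<lambda>j. log_gap (x $ j) (y $ j)"
  have F: "0 \<le> ?F j" for j
    by (intro log_gap_nonneg rel_interior_pos[OF x] rel_interior_pos[OF y])
  \<comment> \<open>Each negative term is distributed over the coordinates by
    \<open>log_gap_sum_le\<close>, with the entries of \<open>a p\<close> as weights.\<close>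
  have "(\<Sum>p=1..<n. \<alpha> (Suc p) * log_gap (a p \<bullet> x) (a p \<bullet> y))
      \<le> (\<Sum>p=1..<n. \<alpha> (Suc p) * (\<Sum>j\<in>UNIV. a p $ j * ?F j))"
  proof (intro sum_mono mult_left_mono)
    fix p assume p: "p \<in> {1..<n}"
    show "log_gap (a p \<bullet> x) (a p \<bullet> y) \<le> (\<Sum>j\<in>UNIV. a p $ j * ?F j)"
      using log_gap_sum_le[of UNIV "\<lambda>j. a p $ j" "\<lambda>j. x $ j" "\<lambda>j. y $ j"] a_bounds[OF p]
        rel_interior_pos[OF x] rel_interior_pos[OF y]
        rel_interior_inner_pos[OF x p] rel_interior_inner_pos[OF y p]
      by (simp add: inner_vec_def)
    show "0 \<le> \<alpha> (Suc p)" using coeff_ge_1[of "Suc p"] by simp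
  qed
  also have "\<dots> = (\<Sum>j\<in>UNIV. (\<Sum>p=1..<n. \<alpha> (Suc p) * a p $ j) * ?F j)"
    unfolding sum_distrib_left sum_distrib_right mult.assoc by (rule sum.swap)
  \<comment> \<open>By \<open>coeff_ge\<close> the total charged to coordinate \<open>j\<close> is
    at most its own weight minus 1.\<close>
  also have "\<dots> \<le> (\<Sum>j\<in>UNIV. (\<alpha> (blk j) - 1) * ?F j)"
    using coeff_ge F by (intro sum_mono mult_right_mono) (auto simp: algebra_simps)
  also have "\<dots> = (\<Sum>j\<in>UNIV. \<alpha> (blk j) * ?F j) - (\<Sum>j\<in>UNIV. ?F j)"
    by (simp add: left_diff_distrib sum_subtractf)
  finally have "(\<Sum>j\<in>UNIV. ?F j) \<le> entropy_deriv x (x - y) - entropy_deriv y (x - y)"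
    unfolding entropy_deriv_gap by linarith
  moreover have "(\<Sum>j\<in>UNIV. (x $ j - y $ j)\<^sup>2 / ((x $ j + y $ j) / 2)) \<le> (\<Sum>j\<in>UNIV. ?F j)"
    by (intro sum_mono log_gap_ge rel_interior_pos[OF x] rel_interior_pos[OF y])
  ultimately show ?thesis by linarith
qed

text \<open>Coordinates are at most 1, so the denominators are at most 1 too.\<close>

lemma norm_gap_le:
  assumes x: "x \<in> rel_interior X" and y: "y \<in> rel_interior X"
  shows "(norm (x - y))\<^sup>2 \<le> (\<Sum>j\<in>UNIV. (x $ j - y $ j)\<^sup>2 / ((x $ j + y $ j) / 2))"
proof -
  have "(norm (x - y))\<^sup>2 = (\<Sum>j\<in>UNIV. (x $ j - y $ j)\<^sup>2)"
    by (simp add: power2_norm_eq_inner inner_vec_def) (simp add: power2_eq_square)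
  also have "\<dots> \<le> (\<Sum>j\<in>UNIV. (x $ j - y $ j)\<^sup>2 / ((x $ j + y $ j) / 2))"
  proof (rule sum_mono)
    fix j
    have "x \<in> X" "y \<in> X" using x y rel_interior_subset by auto
    then have m: "(x $ j + y $ j) / 2 \<le> 1" "0 < (x $ j + y $ j) / 2"
      using chain_polytope_component_le_1[of x j] chain_polytope_component_le_1[of y j]
        rel_interior_pos[OF x, of j] rel_interior_pos[OF y, of j] by auto
    have "(x $ j - y $ j)\<^sup>2 / 1 \<le> (x $ j - y $ j)\<^sup>2 / ((x $ j + y $ j) / 2)"
      using m by (intro divide_left_mono) auto
    then show "(x $ j - y $ j)\<^sup>2 \<le> (x $ j - y $ j)\<^sup>2 / ((x $ j + y $ j) / 2)" by simp
  qed
  finally show ?thesis .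
qed

text \<open>The means \<open>?m j\<close> of the coordinates sum to the average of the two \<ell>1
  norms, which is at most the maximum over \<open>X\<close>. Cauchy-Schwarz with these means as
  weights gives the bound.\<close>

lemma l1_norm_gap_le:
  assumes x: "x \<in> rel_interior X" and y: "y \<in> rel_interior X"
  shows "1 / max_l1_norm X * (l1_norm (x - y))\<^sup>2
    \<le> (\<Sum>j\<in>UNIV. (x $ j - y $ j)\<^sup>2 / ((x $ j + y $ j) / 2))" (is "_ \<le> ?S")
proof -
  let ?m = "\<lambda>j. (x $ j + y $ j) / 2"
  have m: "0 < ?m j" for j using rel_interior_pos[OF x, of j] rel_interior_pos[OF y, of j] by simp
  have X: "x \<in> X" "y \<in> X" using x y rel_interior_subset by auto
  have S: "0 \<le> ?S" using m by (intro sum_nonneg divide_nonneg_pos) auto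
  have "(\<Sum>j\<in>UNIV. ?m j) = (l1_norm x + l1_norm y) / 2"
    using rel_interior_pos[OF x] rel_interior_pos[OF y]
    by (simp add: l1_norm_def sum.distrib less_imp_le flip: sum_divide_distrib)
  also have "\<dots> \<le> max_l1_norm X"
    using l1_norm_le_max[OF X(1)] l1_norm_le_max[OF X(2)] by simp
  finally have M: "(\<Sum>j\<in>UNIV. ?m j) \<le> max_l1_norm X" .
  have M0: "0 < max_l1_norm X"
    using m by (intro less_le_trans[OF sum_pos M]) auto
  \<comment> \<open>Splitting off \<open>sqrt (?m j)\<close> makes the squares of the two factors
    the summands of \<open>?S\<close> and the weights.\<close>
  have "l1_norm (x - y) = (\<Sum>j\<in>UNIV. (\<bar>x $ j - y $ j\<bar> / sqrt (?m j)) * sqrt (?m j))"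
    unfolding l1_norm_def using m by (intro sum.cong) (auto simp: less_imp_neq[symmetric])
  then have "(l1_norm (x - y))\<^sup>2
      \<le> (\<Sum>j\<in>UNIV. (\<bar>x $ j - y $ j\<bar> / sqrt (?m j))\<^sup>2) * (\<Sum>j\<in>UNIV. (sqrt (?m j))\<^sup>2)"
    by (simp only: Cauchy_Schwarz_ineq_sum)
  also have "\<dots> = ?S * (\<Sum>j\<in>UNIV. ?m j)"
    using m by (simp add: power_divide less_imp_le)
  also have "\<dots> \<le> ?S * max_l1_norm X"
    using S M by (intro mult_left_mono) auto
  finally show ?thesis using M0 by (simp add: divide_le_eq)
qed

lemma strongly_convex_entropy:
  "strongly_convex_wrt 1 norm X (dilatable_global_entropy blk s a n)"
  "strongly_convex_wrt (1 / max_l1_norm X) l1_norm X (dilatable_global_entropy blk s a n)"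
proof -
  show "strongly_convex_wrt 1 norm X (dilatable_global_entropy blk s a n)"
    by (rule strongly_convex_wrtI[OF convex_chain_polytope has_derivative_entropy])
      (simp_all only: mult_1 order_trans[OF norm_gap_le entropy_deriv_gap_ge])
  show "strongly_convex_wrt (1 / max_l1_norm X) l1_norm X (dilatable_global_entropy blk s a n)"
    by (rule strongly_convex_wrtI[OF convex_chain_polytope has_derivative_entropy])
      (simp_all only: order_trans[OF l1_norm_gap_le entropy_deriv_gap_ge])
qed

end

theorem theorem7:
  fixes n :: nat and s :: "nat \<Rightarrow> nat" and blk :: "'i::finite \<Rightarrow> nat" and a :: "nat \<Rightarrow> real ^ 'i"
  assumes "n \<ge> 1"
    and "\<And>j. blk j \<in> {1..n}"
    and "\<And>k. k \<in> {1..n} \<Longrightarrow> s k \<ge> 1"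
    and "\<And>k. k \<in> {1..n} \<Longrightarrow> card {j. blk j = k} = s k"
    and "\<And>k j. k \<in> {1..<n} \<Longrightarrow> blk j \<le> k \<Longrightarrow> a k $ j \<in> {0..1}"
    and "\<And>k j. k \<in> {1..<n} \<Longrightarrow> blk j > k \<Longrightarrow> a k $ j = 0"
    and "\<And>k u. k \<in> {1..<n} \<Longrightarrow> u \<in> simplex_chain blk a k \<Longrightarrow> scale_fun blk a k u \<ge> 0"
    and "\<And>k u. k \<in> {1..<n} \<Longrightarrow> u \<in> rel_interior (simplex_chain blk a k) \<Longrightarrow> scale_fun blk a k u > 0"
    and "\<And>k u. k \<in> {1..<n} \<Longrightarrow> u \<in> simplex_chain blk a k \<Longrightarrow> scale_fun blk a k u \<le> 1"
  shows "strongly_convex_wrt 1 norm (simplex_chain blk a n) (dilatable_global_entropy blk s a n)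
       \<and> strongly_convex_wrt (1 / max_l1_norm (simplex_chain blk a n)) l1_norm (simplex_chain blk a n)
           (dilatable_global_entropy blk s a n)"
proof -
  interpret simplex_chain_data n s blk a
  proof
    show "{j. blk j = k} \<noteq> {}" if "k \<in> {1..n}" for k
      using assms(3,4)[OF that] by (metis card.empty not_one_le_zero)
    show "0 \<le> a k $ j" if "k \<in> {1..<n}" for k j
      using assms(5,6)[OF that, of j] by (cases "blk j \<le> k") auto
  qed (use assms in auto)
  have "simplex_chain blk a n = X"
    using assms(1) by (intro simplex_chain_eq_polytope) simp
  then show ?thesis using strongly_convex_entropy by simp
qed

end
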